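(* Let $\mathbf{M}$ be a matroid with rank function $r$, and let $A$ and $B$ be bases of $\mathbf{M}$. For any $X\subseteq A\setminus B$ and $Y\subseteq B\setminus A$, there exist $U \subseteq A\setminus B$ and $V \subseteq B \setminus A$ such that $X\subseteq U$, $Y \subseteq V$, $|U| = |V|\le r(X\cup Y)$, and both $(A\setminus U)\cup V$ and $(B\setminus V)\cup U$ are bases of $\mathbf{M}$.
   Context: The rank function of a matroid with basis family $\mathcal{B}$ is $r(S)=\max\{|S\cap B| : B\in\mathcal{B}\}$. *)

theory Defs
  imports Main
begin

locale matroid =
  fixes ground :: "'a set" and bases :: "'a set set"
  assumes finite_ground: "finite ground"
    and bases_subset: "B \<in> bases \<Longrightarrow> B \<subseteq> ground"
    and bases_nonempty: "bases \<noteq> {}"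
    and basis_exchange:
      "\<lbrakk>A \<in> bases; B \<in> bases; x \<in> A - B\<rbrakk> \<Longrightarrow> \<exists>y \<in> B - A. insert y (A - {x}) \<in> bases"

definition matroid_rank :: "'a set set \<Rightarrow> 'a set \<Rightarrow> nat" where
  "matroid_rank bases S = Max {card (S \<inter> B) | B. B \<in> bases}"

text \<open>In a matroid the maximum is taken over a finite nonempty set, hence is attained.\<close>

lemma (in matroid) finite_nonempty_rank_set:
  "finite {card (S \<inter> B) | B. B \<in> bases}" "{card (S \<inter> B) | B. B \<in> bases} \<noteq> {}"
proof -
  have "bases \<subseteq> Pow ground" using bases_subset by blast
  then have "finite bases" using finite_ground by (simp add: finite_subset)
  then show "finite {card (S \<inter> B) | B. B \<in> bases}" by simp
  show "{card (S \<inter> B) | B. B \<in> bases} \<noteq> {}" using bases_nonempty by blast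
qed

end

theory Submission
  imports Defs
begin

text \<open>
  After contracting \<open>A \<inter> B\<close> one looks for a partition of \<open>A \<union> B\<close> into two bases \<open>T \<supseteq> X\<close> and
  \<open>S \<supseteq> Y\<close> with \<open>card (T \<inter> A) \<le> r (X \<union> Y)\<close>. This is a weighted matroid intersection problem.
  Its dual variables are chains \<open>L\<close> of subsets of \<open>(A - X) \<union> (B - Y)\<close>, the dual objective is a sum
  of ranks, and repeated use of submodularity along the chain bounds the objective from below by
  \<open>card A - r (X \<union> Y)\<close>. For a chain minimizing the objective, pushing a set \<open>J\<close> one level down the
  chain does not decrease the objective; this says precisely that the two matroids layered along
  the chain satisfy the covering condition \<open>card J \<le> \<rho>\<^sub>1 J + \<rho>\<^sub>2 J\<close>. The resulting partition
  satisfies complementary slackness, hence attains the dual value.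
\<close>

section \<open>Covering by two submodular functions\<close>

definition submodular :: "('a set \<Rightarrow> int) \<Rightarrow> bool" where
  "submodular f \<longleftrightarrow> (\<forall>S T. f (S \<union> T) + f (S \<inter> T) \<le> f S + f T)"

lemma submodularD: "submodular f \<Longrightarrow> f (S \<union> T) + f (S \<inter> T) \<le> f S + f T"
  by (simp add: submodular_def)

lemma submodular_insert: "submodular f \<Longrightarrow> submodular (\<lambda>S. f (insert e S) - c)"
  unfolding submodular_def
proof (intro allI)
  fix S T
  assume "\<forall>S T. f (S \<union> T) + f (S \<inter> T) \<le> f S + f T"
  then have "f (insert e S \<union> insert e T) + f (insert e S \<inter> insert e T) \<le> f (insert e S) + f (insert e T)"
    by blast
  moreover have "insert e S \<union> insert e T = insert e (S \<union> T)"
    "insert e S \<inter> insert e T = insert e (S \<inter> T)" by auto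
  ultimately show "f (insert e (S \<union> T)) - c + (f (insert e (S \<inter> T)) - c)
      \<le> f (insert e S) - c + (f (insert e T) - c)" by simp
qed

text \<open>Elements are charged one at a time to \<open>f\<close> or to \<open>g\<close>: charging
  \<open>e\<close> replaces that function by its value on \<open>insert e S\<close> minus one, which
  must preserve the hypothesis on the smaller set. If both choices fail, uncrossing the two
  violating sets contradicts the hypothesis.\<close>

lemma submodular_covering:
  assumes "finite E" "submodular f" "submodular g"
    and "\<And>S. S \<subseteq> E \<Longrightarrow> int (card S) \<le> f S + g S"
  shows "\<exists>T \<subseteq> E. int (card E) \<le> f T + g (E - T)"
  using assms
proof (induction E arbitrary: f g rule: finite_induct)
  case empty
  show ?case using empty(3)[of "{}"] by (intro exI[of _ "{}"]) simp
next
  case (insert e E)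
  have fin: "finite S" if "S \<subseteq> E" for S
    using that insert.hyps(1) finite_subset by blast
  have e: "e \<notin> S" if "S \<subseteq> E" for S
    using that insert.hyps(2) by blast
  consider (f) "\<forall>S \<subseteq> E. int (card S) \<le> f (insert e S) - 1 + g S"
    | (g) "\<forall>S \<subseteq> E. int (card S) \<le> f S + (g (insert e S) - 1)"
    | (none) "\<not> (\<forall>S \<subseteq> E. int (card S) \<le> f (insert e S) - 1 + g S)"
        "\<not> (\<forall>S \<subseteq> E. int (card S) \<le> f S + (g (insert e S) - 1))"
    by argo
  then show ?case
  proof cases
    case f
    have "\<exists>T \<subseteq> E. int (card E) \<le> f (insert e T) - 1 + g (E - T)"
      by (rule insert.IH[of "\<lambda>S. f (insert e S) - 1" g])
        (use f in \<open>simp_all only: submodular_insert[OF insert.prems(1)] insert.prems(2) simp_thms\<close>)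
    then obtain T where T: "T \<subseteq> E" "int (card E) \<le> f (insert e T) - 1 + g (E - T)" by blast
    have "insert e E - insert e T = E - T" using insert.hyps(2) by auto
    then show ?thesis
      using T insert.hyps by (intro exI[of _ "insert e T"]) auto
  next
    case g
    have "\<exists>T \<subseteq> E. int (card E) \<le> f T + (g (insert e (E - T)) - 1)"
      by (rule insert.IH[of f "\<lambda>S. g (insert e S) - 1"])
        (use g in \<open>simp_all only: submodular_insert[OF insert.prems(2)] insert.prems(1) simp_thms\<close>)
    then obtain T where T: "T \<subseteq> E" "int (card E) \<le> f T + (g (insert e (E - T)) - 1)" by blast
    have "insert e E - T = insert e (E - T)" using e[OF T(1)] by auto
    then show ?thesis
      using T insert.hyps by (intro exI[of _ T]) auto
  next
    case none
    obtain S1 where S1: "S1 \<subseteq> E" "f (insert e S1) - 1 + g S1 < int (card S1)"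
      using none(1) by (auto simp only: not_all not_imp not_le)
    obtain S2 where S2: "S2 \<subseteq> E" "f S2 + (g (insert e S2) - 1) < int (card S2)"
      using none(2) by (auto simp only: not_all not_imp not_le)
    \<comment> \<open>Only one of the two arguments contains \<open>e\<close>, so \<open>e\<close>
      survives in the union but not in the intersection. This gives the extra unit that makes the
      added inequalities contradictory.\<close>
    have f: "f (insert e (S1 \<union> S2)) + f (S1 \<inter> S2) \<le> f (insert e S1) + f S2"
      using submodularD[OF insert.prems(1), of "insert e S1" S2] e[OF S2(1)] by simp
    have g: "g (insert e (S1 \<union> S2)) + g (S1 \<inter> S2) \<le> g S1 + g (insert e S2)"
      using submodularD[OF insert.prems(2), of S1 "insert e S2"] e[OF S1(1)] by simp
    have "int (card (insert e (S1 \<union> S2))) \<le> f (insert e (S1 \<union> S2)) + g (insert e (S1 \<union> S2))"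
      "int (card (S1 \<inter> S2)) \<le> f (S1 \<inter> S2) + g (S1 \<inter> S2)"
      using S1(1) S2(1) by (auto intro!: insert.prems(3))
    moreover have "card (insert e (S1 \<union> S2)) = Suc (card (S1 \<union> S2))"
      using S1(1) S2(1) by (simp add: fin e)
    moreover have "card S1 + card S2 = card (S1 \<union> S2) + card (S1 \<inter> S2)"
      using S1(1) S2(1) by (intro card_Un_Int fin)
    ultimately have False using f g S1(2) S2(2) by linarith
    then show ?thesis ..
  qed
qed

section \<open>Rank functions and layering along a chain\<close>

locale rank_function =
  fixes r :: "'a set \<Rightarrow> int"
  assumes empty: "r {} = 0"
    and mono: "S \<subseteq> T \<Longrightarrow> r S \<le> r T"
    and submod: "submodular r"
    and le_card: "finite S \<Longrightarrow> r S \<le> int (card S)"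
begin

lemma submodularity: "r (S \<union> T) + r (S \<inter> T) \<le> r S + r T"
  by (rule submodularD[OF submod])

lemma submodularity':
  assumes "C \<subseteq> S \<union> T" "D \<subseteq> S \<inter> T"
  shows "r C + r D \<le> r S + r T"
  using mono[OF assms(1)] mono[OF assms(2)] submodularity[of S T] by linarith

lemma subadditive: "r (S \<union> T) \<le> r S + r T"
  using submodularity[of S T] mono[of "{}" "S \<inter> T"] empty by simp

lemma contract: "rank_function (\<lambda>S. r (S \<union> C) - r C)"
proof
  show "r ({} \<union> C) - r C = 0" by simp
  show "r (S \<union> C) - r C \<le> r (T \<union> C) - r C" if "S \<subseteq> T" for S T
    using that by (auto intro!: mono)
  show "submodular (\<lambda>S. r (S \<union> C) - r C)"
    unfolding submodular_def
  proof (intro allI)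
    fix S T
    have "r ((S \<union> T) \<union> C) + r ((S \<inter> T) \<union> C) \<le> r (S \<union> C) + r (T \<union> C)"
      by (rule submodularity') auto
    then show "r (S \<union> T \<union> C) - r C + (r (S \<inter> T \<union> C) - r C) \<le> r (S \<union> C) - r C + (r (T \<union> C) - r C)"
      by simp
  qed
  show "r (S \<union> C) - r C \<le> int (card S)" if "finite S" for S
    using le_card[OF that] subadditive[of S C] by linarith
qed

text \<open>Subadditivity over \<open>S\<close> and \<open>T - S\<close> leaves no room for a rank
  deficit in either part.\<close>

lemma independent_subset:
  assumes "finite T" "r T = int (card T)" "S \<subseteq> T"
  shows "r S = int (card S)"
proof -
  have "r T \<le> r S + r (T - S)"
    using subadditive[of S "T - S"] assms(3) by (simp add: Un_absorb1)
  moreover have "int (card T) = int (card S) + int (card (T - S))"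
    using assms by (simp add: card_Diff_subset finite_subset card_mono of_nat_diff)
  ultimately show ?thesis
    using le_card[of S] le_card[of "T - S"] assms finite_subset by fastforce
qed

text \<open>For an increasing chain this is a matroid rank in a direct sum of minors: the i-th
  summand lives on \<open>L (Suc i) - L i\<close> and has \<open>L i\<close> contracted.\<close>

definition layered :: "(nat \<Rightarrow> 'a set) \<Rightarrow> nat \<Rightarrow> 'a set \<Rightarrow> int" where
  "layered L k J = (\<Sum>i<k. r (L i \<union> (J \<inter> L (Suc i))) - r (L i))"

lemma submodular_layered: "submodular (layered L k)"
  unfolding submodular_def
proof (intro allI)
  fix S T
  have "r (L i \<union> ((S \<union> T) \<inter> L (Suc i))) + r (L i \<union> ((S \<inter> T) \<inter> L (Suc i)))
      \<le> r (L i \<union> (S \<inter> L (Suc i))) + r (L i \<union> (T \<inter> L (Suc i)))" for i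
    by (rule submodularity') auto
  then show "layered L k (S \<union> T) + layered L k (S \<inter> T) \<le> layered L k S + layered L k T"
    unfolding layered_def sum.distrib[symmetric] by (intro sum_mono) (smt (verit))
qed

section \<open>Sets of full layered rank\<close>

context
  fixes L :: "nat \<Rightarrow> 'a set" and k :: nat and T :: "'a set"
  assumes L0: "L 0 = {}" and Lk: "\<And>i. L i \<subseteq> L (Suc i)"
    and finL: "\<And>i. finite (L i)" and T: "T \<subseteq> L k"
begin

lemma layered_term_le:
  "r (L i \<union> (T \<inter> L (Suc i))) - r (L i) \<le> int (card (T \<inter> L (Suc i))) - int (card (T \<inter> L i))"
proof -
  have "L i \<union> (T \<inter> L (Suc i)) = L i \<union> (T \<inter> L (Suc i) - T \<inter> L i)" by auto
  then have "r (L i \<union> (T \<inter> L (Suc i))) \<le> r (L i) + int (card (T \<inter> L (Suc i) - T \<inter> L i))"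
    using subadditive[of "L i" "T \<inter> L (Suc i) - T \<inter> L i"]
      le_card[of "T \<inter> L (Suc i) - T \<inter> L i"] finL by fastforce
  also have "int (card (T \<inter> L (Suc i) - T \<inter> L i)) = int (card (T \<inter> L (Suc i))) - int (card (T \<inter> L i))"
    using Lk[of i] finL by (subst card_Diff_subset) (auto intro!: of_nat_diff card_mono)
  finally show ?thesis by linarith
qed

lemma telescope_card:
  "(\<Sum>i<k. int (card (T \<inter> L (Suc i))) - int (card (T \<inter> L i))) = int (card T)"
  unfolding sum_lessThan_telescope[of "\<lambda>i. int (card (T \<inter> L i))"] using T L0
  by (simp add: Int_absorb2)

lemma layered_le_card: "layered L k T \<le> int (card T)"
  unfolding layered_def telescope_card[symmetric] by (rule sum_mono) (rule layered_term_le)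

context
  assumes full: "layered L k T = int (card T)"
begin

text \<open>Termwise upper bounds whose totals agree must all be equalities.\<close>

lemma layered_term_eq:
  assumes "i < k"
  shows "r (L i \<union> (T \<inter> L (Suc i))) - r (L i) = int (card (T \<inter> L (Suc i))) - int (card (T \<inter> L i))"
  using full unfolding layered_def telescope_card[symmetric]
  by (rule sum_mono_inv) (use layered_term_le assms in auto)

text \<open>Independence climbs the chain: by submodularity, what
  \<open>T \<inter> L (Suc j)\<close> adds to the rank of \<open>L j\<close> it also adds, at least,
  to that of the smaller set \<open>T \<inter> L j\<close>.\<close>

lemma layered_independent: "r T = int (card T)"
proof -
  have "int (card (T \<inter> L j)) \<le> r (T \<inter> L j)" if "j \<le> k" for j
    using that
  proof (induction j)
    case 0
    then show ?case by (simp add: L0 empty)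
  next
    case (Suc j)
    have "r (L j \<union> (T \<inter> L (Suc j))) + r (T \<inter> L j) \<le> r (L j) + r (T \<inter> L (Suc j))"
      by (rule submodularity') (use Lk in auto)
    then show ?case using Suc layered_term_eq[of j] by simp
  qed
  from this[of k] have "int (card T) \<le> r T" using T by (simp add: Int_absorb2)
  moreover have "finite T" using T finL finite_subset by blast
  ultimately show ?thesis using le_card by fastforce
qed

text \<open>Supplies the complementary slackness conditions. Descending from the top, where
  \<open>T\<close> spans by assumption, each tight layer leaves \<open>L i\<close> no more rank than
  \<open>T\<close> has elements in it.\<close>

lemma layered_spanning:
  assumes "r (L k) \<le> int (card T)" "i \<le> k"
  shows "r (L i) \<le> int (card (T \<inter> L i))"
  using assms(2)
proof (induction rule: inc_induct)
  case base
  then show ?case using assms(1) T by (simp add: Int_absorb2)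
next
  case (step n)
  have "r (L n \<union> (T \<inter> L (Suc n))) \<le> r (L (Suc n))"
    by (rule mono) (use Lk in auto)
  then show ?case using step layered_term_eq[of n] by simp
qed

end

end

end

section \<open>Duality for two rank functions\<close>

text \<open>
  A chain \<open>L\<close> encodes the potential sending \<open>e\<close> to the least \<open>i\<close> with \<open>e \<in> L i\<close>. Up to a constant,
  \<open>shifted P Q L\<close> encodes this potential minus the weight that is \<open>1\<close> on \<open>P\<close> and \<open>0\<close> on \<open>Q\<close>. At \<open>i = 0\<close> the truncated \<open>i - 1\<close> is harmless because \<open>L 0 = {}\<close>.
\<close>

definition shifted :: "'a set \<Rightarrow> 'a set \<Rightarrow> (nat \<Rightarrow> 'a set) \<Rightarrow> nat \<Rightarrow> 'a set" where
  "shifted P Q L i = (P \<inter> L i) \<union> (Q \<inter> L (i - 1))"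

text \<open>Levels may repeat, and the chain stays at \<open>E\<close> beyond \<open>k\<close>, so
  the indices \<open>Suc k\<close> and \<open>Suc (Suc k)\<close> needed by the lagging shifted
  chain are meaningful.\<close>

definition chain_to :: "'a set \<Rightarrow> nat \<Rightarrow> (nat \<Rightarrow> 'a set) \<Rightarrow> bool" where
  "chain_to E k L \<longleftrightarrow> L 0 = {} \<and> (\<forall>i. L i \<subseteq> L (Suc i)) \<and> (\<forall>i \<ge> k. L i = E)"

lemma chain_toD:
  assumes "chain_to E k L"
  shows "L 0 = {}" "L i \<subseteq> L (Suc i)" "k \<le> i \<Longrightarrow> L i = E"
  using assms unfolding chain_to_def by blast+

lemma chain_to_subset:
  assumes "chain_to E k L"
  shows "L i \<subseteq> E"
proof -
  have "L i \<subseteq> L (max i k)"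
    by (rule lift_Suc_mono_le[of L]) (simp_all add: chain_toD(2)[OF assms])
  also have "L (max i k) = E" by (rule chain_toD(3)[OF assms]) simp
  finally show ?thesis .
qed

text \<open>Let \<open>P\<close>, \<open>Q\<close> be finite and disjoint, and let
  \<open>P \<union> Q\<close> split into \<open>T\<close> independent for \<open>f\<close> and
  \<open>S\<close> independent for \<open>g\<close>. Bounding the ranks below by
  \<open>card (T \<inter> L i)\<close> and \<open>card (S \<inter> shifted P Q L i)\<close> makes
  the sum telescope to \<open>card (P - T)\<close>, so every chain to \<open>P \<union> Q\<close>
  gives an upper bound for it. The \<open>g\<close>-sum runs one level further because the
  \<open>Q\<close> part of \<open>shifted\<close> lags by one.\<close>

definition dual_value ::
    "('a set \<Rightarrow> int) \<Rightarrow> ('a set \<Rightarrow> int) \<Rightarrow> 'a set \<Rightarrow> 'a set \<Rightarrow> nat \<Rightarrow> (nat \<Rightarrow> 'a set) \<Rightarrow> int" where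
  "dual_value f g P Q k L =
     (\<Sum>i\<le>k. f (L i) - int (card (L i))) + (\<Sum>i\<le>Suc k. g (shifted P Q L i))"

text \<open>Elements of \<open>J\<close> keep their potential and all others are raised by one.
  Relative to the others \<open>J\<close> moves down, while level \<open>0\<close> stays empty; the
  price is a chain longer by one.\<close>

definition push_down :: "'a set \<Rightarrow> (nat \<Rightarrow> 'a set) \<Rightarrow> nat \<Rightarrow> 'a set" where
  "push_down J L i = (case i of 0 \<Rightarrow> {} | Suc j \<Rightarrow> L j \<union> (J \<inter> L (Suc j)))"

lemma push_down_simps [simp]:
  "push_down J L 0 = {}" "push_down J L (Suc j) = L j \<union> (J \<inter> L (Suc j))"
  by (simp_all add: push_down_def)

lemma chain_to_push_down:
  assumes "chain_to E k L"
  shows "chain_to E (Suc k) (push_down J L)"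
  unfolding chain_to_def
proof (intro conjI allI impI)
  fix i
  have L: "L j \<subseteq> L (Suc j)" for j by (rule chain_toD(2)[OF assms])
  show "push_down J L i \<subseteq> push_down J L (Suc i)"
    using L by (cases i) (simp, force)
  show "push_down J L i = E" if "Suc k \<le> i"
    using that chain_toD(3)[OF assms] by (cases i) auto
qed simp

text \<open>Pushing commutes with shifting, so the chain seen by \<open>g\<close> is pushed by the
  same \<open>J\<close>. The case \<open>i = 0\<close> relies on \<open>L 0 = {}\<close>.\<close>

lemma shifted_push_down:
  assumes "L 0 = {}"
  shows "shifted P Q (push_down J L) (Suc i) = shifted P Q L i \<union> (J \<inter> shifted P Q L (Suc i))"
  using assms by (cases i) (auto simp: shifted_def)

text \<open>Compare level \<open>Suc i\<close> of the pushed chain with level \<open>i\<close> of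
  \<open>L\<close>: the rank differences are the terms of \<open>layered\<close>, and the
  cardinality differences telescope to \<open>card J\<close>. The new level \<open>0\<close>
  contributes nothing.\<close>

lemma dual_value_push_down:
  assumes f: "rank_function f" and g: "rank_function g" and L: "chain_to E k L"
    and E: "finite E" "J \<subseteq> E"
  shows "dual_value f g P Q (Suc k) (push_down J L) - dual_value f g P Q k L =
    rank_function.layered f L (Suc k) J + rank_function.layered g (shifted P Q L) (Suc (Suc k)) J
      - int (card J)"
proof -
  have L0: "L 0 = {}" and Li: "L i \<subseteq> L (Suc i)" for i by (rule chain_toD[OF L])+
  have fin: "finite (L i)" for i using chain_to_subset[OF L] E(1) finite_subset by blast
  have card: "int (card (L i \<union> (J \<inter> L (Suc i)))) - int (card (L i)) =
      int (card (J \<inter> L (Suc i))) - int (card (J \<inter> L i))" for i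
  proof -
    have "card (L i) + card (J \<inter> L (Suc i)) =
        card (L i \<union> (J \<inter> L (Suc i))) + card (L i \<inter> (J \<inter> L (Suc i)))"
      using fin by (intro card_Un_Int) auto
    also have "L i \<inter> (J \<inter> L (Suc i)) = J \<inter> L i" using Li[of i] by auto
    finally show ?thesis by linarith
  qed
  have J: "(\<Sum>i\<le>k. int (card (L i \<union> (J \<inter> L (Suc i)))) - int (card (L i))) = int (card J)"
    unfolding card lessThan_Suc_atMost[symmetric]
    by (rule rank_function.telescope_card[where L=L, OF f L0 Li fin])
      (use E(2) chain_toD(3)[OF L, of "Suc k"] in simp)
  have 1: "(\<Sum>i\<le>Suc k. f (push_down J L i) - int (card (push_down J L i))) =
     (\<Sum>i\<le>k. f (L i \<union> (J \<inter> L (Suc i))) - int (card (L i \<union> (J \<inter> L (Suc i)))))"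
    by (subst sum.atMost_Suc_shift) (simp add: rank_function.empty[OF f])
  have 2: "(\<Sum>i\<le>Suc (Suc k). g (shifted P Q (push_down J L) i)) =
     (\<Sum>i\<le>Suc k. g (shifted P Q L i \<union> (J \<inter> shifted P Q L (Suc i))))"
    by (subst sum.atMost_Suc_shift)
      (simp add: shifted_push_down[of L, OF L0] shifted_def[of P Q _ 0] rank_function.empty[OF g])
  show ?thesis
    unfolding dual_value_def 1 2 J[symmetric]
      rank_function.layered_def[OF f] rank_function.layered_def[OF g] lessThan_Suc_atMost
    by (simp add: sum_subtractf)
qed

text \<open>Strong duality for maximizing \<open>card (P - T)\<close>: at a minimizing chain the
  covering theorem yields a partition for which all inequalities of weak duality are tight. The
  bound \<open>c\<close> also guarantees that a minimum exists.\<close>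

lemma weighted_covering:
  fixes f g :: "'a set \<Rightarrow> int"
  assumes f: "rank_function f" and g: "rank_function g"
    and fin: "finite P" "finite Q" and disj: "P \<inter> Q = {}"
    and rank_sum: "f (P \<union> Q) + g (P \<union> Q) = int (card (P \<union> Q))"
    and bound: "\<And>k L. chain_to (P \<union> Q) k L \<Longrightarrow> c \<le> dual_value f g P Q k L"
  shows "\<exists>T \<subseteq> P \<union> Q. f T = int (card T) \<and> g (P \<union> Q - T) = int (card (P \<union> Q - T)) \<and>
    c \<le> int (card (P - T))"
proof -
  interpret f: rank_function f by fact
  interpret g: rank_function g by fact
  define E where "E = P \<union> Q"
  have E: "finite E" using fin by (simp add: E_def)
  define val where "val = (\<lambda>(k, L). dual_value f g P Q k L)"
  \<comment> \<open>This chain only shows that there is something to minimize over. Since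
    \<open>val\<close> is at least \<open>c\<close> on chains, \<open>nat\<close> preserves the
    order of \<open>val kL - c\<close>. The length \<open>k\<close> varies too, because pushing
    lengthens the chain.\<close>
  have "chain_to E 1 (\<lambda>i. if i = 0 then {} else E)" by (auto simp: chain_to_def)
  then have "case (1, \<lambda>i. if i = 0 then {} else E) of (k, L) \<Rightarrow> chain_to E k L" by simp
  then obtain kL where kL: "case kL of (k, L) \<Rightarrow> chain_to E k L"
    and min: "\<And>kL'. (case kL' of (k, L) \<Rightarrow> chain_to E k L) \<Longrightarrow> nat (val kL - c) \<le> nat (val kL' - c)"
    using ex_has_least_nat[of "\<lambda>kL. case kL of (k, L) \<Rightarrow> chain_to E k L" _ "\<lambda>kL. nat (val kL - c)"]
    by blast
  obtain k L where kL_eq: "kL = (k, L)" by (cases kL)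
  have L: "chain_to E k L" using kL kL_eq by simp
  have opt: "dual_value f g P Q k L \<le> dual_value f g P Q k' L'" if "chain_to E k' L'" for k' L'
    using min[of "(k', L')"] that bound[of k L] bound[of k' L'] L
    by (auto simp: val_def kL_eq E_def)
  define K where "K = shifted P Q L"
  have L0: "L 0 = {}" and Li: "L i \<subseteq> L (Suc i)" and LE: "L i \<subseteq> E" for i
    by (rule chain_toD(1,2)[OF L] chain_to_subset[OF L])+
  have finL: "finite (L i)" for i by (rule finite_subset[OF LE E])
  have LSk: "L k = E" "L (Suc k) = E" "L (Suc (Suc k)) = E" by (simp_all add: chain_toD(3)[OF L])
  have K0: "K 0 = {}" by (simp add: K_def shifted_def L0)
  have Ki: "K i \<subseteq> K (Suc i)" for i
    unfolding K_def shifted_def using Li[of i] Li[of "i - 1"] by (cases i) auto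
  have finK: "finite (K i)" for i unfolding K_def shifted_def using finL by simp
  have KSk: "K (Suc k) = E" "K (Suc (Suc k)) = E"
    using LSk by (auto simp: K_def shifted_def E_def)
  have cover: "int (card J) \<le> f.layered L (Suc k) J + g.layered K (Suc (Suc k)) J" if "J \<subseteq> E" for J
    using dual_value_push_down[OF f g L E that, of P Q] opt[OF chain_to_push_down[OF L, of J]]
    by (simp add: K_def)
  obtain T where T: "T \<subseteq> E"
    and sum: "int (card E) \<le> f.layered L (Suc k) T + g.layered K (Suc (Suc k)) (E - T)"
    using submodular_covering[OF E f.submodular_layered g.submodular_layered cover] by blast
  define S where "S = E - T"
  have TS: "T \<subseteq> L (Suc k)" "S \<subseteq> K (Suc (Suc k))" using T LSk KSk by (auto simp: S_def)
  have cardE: "int (card E) = int (card T) + int (card S)"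
    using T E unfolding S_def by (simp add: card_Diff_subset finite_subset card_mono of_nat_diff)
  have "f.layered L (Suc k) T \<le> int (card T)"
    by (rule f.layered_le_card[where L=L, OF L0 Li finL TS(1)])
  moreover have "g.layered K (Suc (Suc k)) S \<le> int (card S)"
    by (rule g.layered_le_card[where L=K, OF K0 Ki finK TS(2)])
  ultimately have fT: "f.layered L (Suc k) T = int (card T)"
    and gS: "g.layered K (Suc (Suc k)) S = int (card S)"
    using sum cardE by (auto simp: S_def)
  have indT: "f T = int (card T)" by (rule f.layered_independent[where L=L, OF L0 Li finL TS(1) fT])
  have indS: "g S = int (card S)" by (rule g.layered_independent[where L=K, OF K0 Ki finK TS(2) gS])
  \<comment> \<open>Both parts are independent and together fill \<open>E\<close>, so
    \<open>rank_sum\<close> forces each of them to span.\<close>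
  have "f T \<le> f E" "g S \<le> g E" using T by (auto simp: S_def intro: f.mono g.mono)
  then have span: "f E \<le> int (card T)" "g E \<le> int (card S)"
    using rank_sum indT indS cardE by (auto simp: E_def)
  have fL: "f (L i) \<le> int (card (T \<inter> L i))" if "i \<le> k" for i
    using f.layered_spanning[where L=L, OF L0 Li finL TS(1) fT] span that LSk by simp
  have gK: "g (K i) \<le> int (card (S \<inter> K i))" if "i \<le> Suc k" for i
    using g.layered_spanning[where L=K, OF K0 Ki finK TS(2) gS] span that KSk by simp
  have split_L: "int (card (L i)) = int (card (T \<inter> L i)) + int (card (S \<inter> P \<inter> L i)) + int (card (S \<inter> Q \<inter> L i))"
    for i
  proof -
    have "L i = (T \<inter> L i) \<union> ((S \<inter> P \<inter> L i) \<union> (S \<inter> Q \<inter> L i))"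
      using LE[of i] by (auto simp: S_def E_def)
    moreover have "card \<dots> = card (T \<inter> L i) + (card (S \<inter> P \<inter> L i) + card (S \<inter> Q \<inter> L i))"
      using disj finL by (subst card_Un_disjoint, (auto simp: S_def)[3],
        subst card_Un_disjoint) auto
    ultimately show ?thesis by simp
  qed
  have split_K: "int (card (S \<inter> K (Suc i))) = int (card (S \<inter> P \<inter> L (Suc i))) + int (card (S \<inter> Q \<inter> L i))"
    for i
  proof -
    have "S \<inter> K (Suc i) = (S \<inter> P \<inter> L (Suc i)) \<union> (S \<inter> Q \<inter> L i)"
      by (auto simp: K_def shifted_def)
    then show ?thesis using disj finL by (simp only:) (subst card_Un_disjoint, auto)
  qed
  have "dual_value f g P Q k L
      = (\<Sum>i\<le>k. f (L i) - int (card (L i))) + (\<Sum>i\<le>k. g (K (Suc i)))"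
    unfolding dual_value_def K_def[symmetric]
    by (subst sum.atMost_Suc_shift[of "\<lambda>i. g (K i)"]) (simp add: K0 g.empty)
  also have "\<dots> \<le> (\<Sum>i\<le>k. int (card (T \<inter> L i)) - int (card (L i))) + (\<Sum>i\<le>k. int (card (S \<inter> K (Suc i))))"
    by (intro add_mono sum_mono diff_mono fL gK) auto
  \<comment> \<open>The \<open>T\<close> parts and the \<open>S \<inter> Q\<close> parts cancel
    level by level; only the \<open>S \<inter> P\<close> parts, taken at consecutive levels,
    remain.\<close>
  also have "\<dots> = (\<Sum>i<Suc k. int (card (S \<inter> P \<inter> L (Suc i))) - int (card (S \<inter> P \<inter> L i)))"
    unfolding sum.distrib[symmetric] lessThan_Suc_atMost
    by (rule sum.cong) (use split_L split_K in \<open>auto simp: algebra_simps\<close>)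
  also have "\<dots> = int (card (S \<inter> P \<inter> E))"
    by (subst sum_lessThan_telescope) (simp add: L0 LSk)
  also have "S \<inter> P \<inter> E = P - T" by (auto simp: S_def E_def)
  finally have "c \<le> int (card (P - T))" using bound[of k L] L by (simp add: E_def)
  then show ?thesis using T indT indS by (auto simp: E_def S_def)
qed

section \<open>Two disjoint bases\<close>

lemma (in rank_function) dual_value_ge:
  assumes "finite A" "finite B" "A \<inter> B = {}"
    and rA: "r A = int (card A)" and rB: "r B = int (card B)"
    and X: "X \<subseteq> A" and Y: "Y \<subseteq> B"
    and L: "chain_to ((A - X) \<union> (B - Y)) k L"
  shows "int (card A) - r (X \<union> Y)
    \<le> dual_value (\<lambda>S. r (S \<union> X) - r X) (\<lambda>S. r (S \<union> Y) - r Y) (A - X) (B - Y) k L"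
proof -
  define P where "P = A - X"
  define Q where "Q = B - Y"
  define K where "K = shifted P Q L"
  have L0: "L 0 = {}" and Li: "L i \<subseteq> L (Suc i)" and LE: "L i \<subseteq> P \<union> Q" for i
    unfolding P_def Q_def by (rule chain_toD(1,2)[OF L] chain_to_subset[OF L])+
  have finPQ: "finite P" "finite Q" using assms by (auto simp: P_def Q_def)
  have finXY: "finite X" "finite Y" using X Y assms finite_subset by blast+
  have indA: "r S = int (card S)" if "S \<subseteq> A" for S
    using independent_subset[OF assms(1) rA that] .
  have indB: "r S = int (card S)" if "S \<subseteq> B" for S
    using independent_subset[OF assms(2) rB that] .
  have rPX: "r (X \<union> (P \<inter> S)) = r X + int (card (P \<inter> S))" for S
  proof -
    have "card (X \<union> (P \<inter> S)) = card X + card (P \<inter> S)"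
      using finPQ finXY by (intro card_Un_disjoint) (auto simp: P_def)
    moreover have "X \<union> (P \<inter> S) \<subseteq> A" using X by (auto simp: P_def)
    ultimately show ?thesis using X by (simp add: indA)
  qed
  have rQY: "r (Y \<union> (Q \<inter> S)) = r Y + int (card (Q \<inter> S))" for S
  proof -
    have "card (Y \<union> (Q \<inter> S)) = card Y + card (Q \<inter> S)"
      using finPQ finXY by (intro card_Un_disjoint) (auto simp: Q_def)
    moreover have "Y \<union> (Q \<inter> S) \<subseteq> B" using Y by (auto simp: Q_def)
    ultimately show ?thesis using Y by (simp add: indB)
  qed
  have card_L: "int (card (L i)) = int (card (P \<inter> L i)) + int (card (Q \<inter> L i))" for i
  proof -
    have "L i = (P \<inter> L i) \<union> (Q \<inter> L i)" using LE[of i] by auto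
    then have "card (L i) = card ((P \<inter> L i) \<union> (Q \<inter> L i))" by simp
    also have "\<dots> = card (P \<inter> L i) + card (Q \<inter> L i)"
      using assms(3) finPQ by (intro card_Un_disjoint) (auto simp: P_def Q_def)
    finally show ?thesis by simp
  qed
  \<comment> \<open>The term \<open>card (Q \<inter> L j)\<close> is a debt: the \<open>Q\<close>
    part of \<open>K\<close> lags, so it is repaid one level later.\<close>
  have partial: "r (X \<union> Y \<union> L j) - r (X \<union> Y) - int (card (Q \<inter> L j))
      \<le> (\<Sum>i\<le>j. r (L i \<union> X) - r X - int (card (L i))) + (\<Sum>i\<le>j. r (K i \<union> Y) - r Y)" for j
  proof (induction j)
    case 0
    then show ?case by (simp add: L0 K_def shifted_def)
  next
    case (Suc j)
    have K: "K (Suc j) = (P \<inter> L (Suc j)) \<union> (Q \<inter> L j)" by (simp add: K_def shifted_def)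
    \<comment> \<open>First enlarge by the \<open>P\<close> part. The intersection contains the
      independent set \<open>Y \<union> (Q \<inter> L j)\<close>, which repays the debt.\<close>
    have "r (X \<union> Y \<union> L j \<union> (P \<inter> L (Suc j))) + r (Y \<union> (Q \<inter> L j))
        \<le> r (X \<union> Y \<union> L j) + r (K (Suc j) \<union> Y)"
      by (rule submodularity') (auto simp: K)
    \<comment> \<open>Then enlarge by the \<open>Q\<close> part. The independent set
      \<open>X \<union> (P \<inter> L (Suc j))\<close> accounts for the \<open>P\<close> share of
      \<open>card (L (Suc j))\<close>; the \<open>Q\<close> share is the new debt.\<close>
    moreover have "r (X \<union> Y \<union> L (Suc j)) + r (X \<union> (P \<inter> L (Suc j)))
        \<le> r (X \<union> Y \<union> L j \<union> (P \<inter> L (Suc j))) + r (L (Suc j) \<union> X)"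
      by (rule submodularity') auto
    ultimately show ?case
      using Suc rPX[of "L (Suc j)"] rQY[of "L j"] card_L[of "Suc j"] by simp
  qed
  have Lk: "L k = P \<union> Q" "L (Suc k) = P \<union> Q"
    unfolding P_def Q_def by (simp_all add: chain_toD(3)[OF L])
  then have KSk: "K (Suc k) = P \<union> Q" by (auto simp: K_def shifted_def)
  \<comment> \<open>The remaining summand, at \<open>K (Suc k)\<close>, is at least
    \<open>card Q\<close> and settles the final debt.\<close>
  have "r B \<le> r (P \<union> Q \<union> Y)" by (rule mono) (auto simp: Q_def)
  moreover have "r A \<le> r (X \<union> Y \<union> (P \<union> Q))" by (rule mono) (auto simp: P_def)
  moreover have "card B = card Y + card Q"
    using Y assms finXY by (simp add: Q_def card_Diff_subset card_mono)
  moreover have "r Y = int (card Y)" using indB Y by blast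
  moreover have "Q \<inter> (P \<union> Q) = Q" by auto
  ultimately show ?thesis
    using partial[of k] rA rB
    unfolding dual_value_def P_def[symmetric] Q_def[symmetric] K_def[symmetric]
    by (simp add: Lk KSk)
qed

text \<open>Contracting \<open>X\<close> on one side and \<open>Y\<close> on the other forces them
  into the two new bases; the elements still to be distributed are those of
  \<open>P \<union> Q\<close>.\<close>

lemma (in rank_function) exchange_disjoint:
  assumes "finite A" "finite B" "A \<inter> B = {}"
    and rA: "r A = int (card A)" and rB: "r B = int (card B)"
    and card_eq: "card A = card B" and rAB: "r (A \<union> B) = int (card B)"
    and X: "X \<subseteq> A" and Y: "Y \<subseteq> B"
  shows "\<exists>U V. X \<subseteq> U \<and> U \<subseteq> A \<and> Y \<subseteq> V \<and> V \<subseteq> B \<and> card U = card V \<and>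
    int (card V) \<le> r (X \<union> Y) \<and>
    r ((A - U) \<union> V) = int (card A) \<and> r ((B - V) \<union> U) = int (card A)"
proof -
  define P where "P = A - X"
  define Q where "Q = B - Y"
  let ?f = "\<lambda>S. r (S \<union> X) - r X" and ?g = "\<lambda>S. r (S \<union> Y) - r Y"
  have fin: "finite P" "finite Q" "finite X" "finite Y"
    using X Y assms finite_subset by (auto simp: P_def Q_def)
  have disj: "P \<inter> Q = {}" using assms(3) by (auto simp: P_def Q_def)
  have rX: "r X = int (card X)" by (rule independent_subset[OF assms(1) rA X])
  have rY: "r Y = int (card Y)" by (rule independent_subset[OF assms(2) rB Y])
  have full: "r (P \<union> Q \<union> X) = int (card A)" "r (P \<union> Q \<union> Y) = int (card A)"
  proof -
    have "r A \<le> r (P \<union> Q \<union> X)" "r (P \<union> Q \<union> X) \<le> r (A \<union> B)"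
      "r B \<le> r (P \<union> Q \<union> Y)" "r (P \<union> Q \<union> Y) \<le> r (A \<union> B)"
      using X Y by (auto simp: P_def Q_def intro!: mono)
    then show "r (P \<union> Q \<union> X) = int (card A)" "r (P \<union> Q \<union> Y) = int (card A)"
      using rA rB rAB card_eq by auto
  qed
  have cards: "card A = card P + card X" "card B = card Q + card Y"
    using X Y fin card_mono[OF assms(1) X] card_mono[OF assms(2) Y]
    by (simp_all add: P_def Q_def card_Diff_subset)
  have cardPQ: "card (P \<union> Q) = card P + card Q" using fin disj by (simp add: card_Un_disjoint)
  obtain T where T: "T \<subseteq> P \<union> Q" and fT: "?f T = int (card T)"
    and gS: "?g (P \<union> Q - T) = int (card (P \<union> Q - T))"
    and weight: "int (card A) - r (X \<union> Y) \<le> int (card (P - T))"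
    using weighted_covering[OF contract[of X] contract[of Y] fin(1,2) disj, of "int (card A) - r (X \<union> Y)"]
      dual_value_ge[OF assms(1-3) rA rB X Y] full rX rY cards card_eq cardPQ
    unfolding P_def Q_def by auto
  \<comment> \<open>Chosen so that \<open>T \<union> X\<close> is \<open>(B - V) \<union> U\<close>
    and its complement is \<open>(A - U) \<union> V\<close>. As \<open>A - U = P - T\<close>, the
    weight bound becomes the bound on \<open>card U\<close>.\<close>
  define U where "U = (T \<inter> P) \<union> X"
  define V where "V = (Q - T) \<union> Y"
  have UV: "X \<subseteq> U" "U \<subseteq> A" "Y \<subseteq> V" "V \<subseteq> B" using X Y by (auto simp: U_def V_def P_def Q_def)
  have AU: "A - U = P - T" and BV: "B - V = T \<inter> Q" by (auto simp: U_def V_def P_def Q_def)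
  have ST: "(A - U) \<union> V = (P \<union> Q - T) \<union> Y" "(B - V) \<union> U = T \<union> X"
    unfolding AU BV using T by (auto simp: U_def V_def)
  \<comment> \<open>These bounds give \<open>card T\<close> at most \<open>card P\<close> and its
    complement at most \<open>card Q\<close>; the sizes add up, so both are equalities.\<close>
  have "r (T \<union> X) \<le> r (P \<union> Q \<union> X)" "r ((P \<union> Q - T) \<union> Y) \<le> r (P \<union> Q \<union> Y)"
    using T by (auto intro!: mono)
  moreover have "card (P \<union> Q) = card T + card (P \<union> Q - T)"
    using T fin by (simp add: card_Diff_subset finite_subset card_mono)
  ultimately have bases: "r (T \<union> X) = int (card A)" "r ((P \<union> Q - T) \<union> Y) = int (card A)"
    and cT: "card T = card P"
    using fT gS full cards cardPQ card_eq rX rY by auto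
  have finU: "finite U" "finite V" using UV assms finite_subset by blast+
  have "card T = card (T \<inter> P) + card (T \<inter> Q)"
  proof -
    have "T = (T \<inter> P) \<union> (T \<inter> Q)" using T by auto
    then have "card T = card ((T \<inter> P) \<union> (T \<inter> Q))" by simp
    also have "\<dots> = card (T \<inter> P) + card (T \<inter> Q)"
      using fin disj by (intro card_Un_disjoint) auto
    finally show ?thesis .
  qed
  moreover have "card U = card (T \<inter> P) + card X"
    unfolding U_def using fin by (intro card_Un_disjoint) (auto simp: P_def)
  moreover have "card B = card V + card (T \<inter> Q)"
    using UV(4) assms(2) finU by (simp add: BV[symmetric] card_Diff_subset card_mono)
  ultimately have "card U = card V" using cT cards card_eq by linarith
  moreover have "card A = card U + card (P - T)"
    using UV(2) assms(1) finU by (simp add: AU[symmetric] card_Diff_subset card_mono)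
  ultimately show ?thesis
    using UV ST bases weight by (intro exI[of _ U] exI[of _ V]) auto
qed

section \<open>The rank function of a matroid\<close>

context matroid
begin

lemma finite_basis: "B \<in> bases \<Longrightarrow> finite B"
  using bases_subset finite_ground finite_subset by blast

text \<open>Each exchange preserves the size of \<open>A\<close> and removes one element of
  \<open>A - B\<close>.\<close>

lemma card_bases_eq:
  assumes "A \<in> bases" "B \<in> bases"
  shows "card A = card B"
  using assms
proof (induction "card (A - B)" arbitrary: A)
  case 0
  then have "A \<subseteq> B" using finite_basis[of A] by auto
  moreover have "B \<subseteq> A" using basis_exchange[of B A] 0 \<open>A \<subseteq> B\<close> by blast
  ultimately show ?case by simp
next
  case (Suc n)
  have "A - B \<noteq> {}"
  proof
    assume "A - B = {}"
    with Suc(2) show False by (simp only: card.empty)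
  qed
  then obtain x where x: "x \<in> A - B" by blast
  then obtain y where y: "y \<in> B - A" "insert y (A - {x}) \<in> bases"
    using basis_exchange Suc.prems by blast
  have "insert y (A - {x}) - B = (A - B) - {x}" using y by auto
  then have "n = card (insert y (A - {x}) - B)" using Suc(2) x by simp
  then have "card (insert y (A - {x})) = card B" using Suc y by blast
  moreover have "card (insert y (A - {x})) = card A"
    using x y finite_basis[OF Suc.prems(1)] card_Suc_Diff1[of A x] by simp
  ultimately show ?case by simp
qed

section \<open>Independent sets, augmentation and submodularity of the rank\<close>

definition indep :: "'a set \<Rightarrow> bool" where
  "indep I \<longleftrightarrow> (\<exists>B \<in> bases. I \<subseteq> B)"

lemma indep_finite: "indep I \<Longrightarrow> finite I"
  unfolding indep_def using finite_basis finite_subset by blast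

text \<open>If augmentation fails, choose bases \<open>A\<close> above \<open>I\<close> and
  \<open>B\<close> above \<open>J\<close> with \<open>B - (J \<union> A)\<close> smallest. Exchanges
  then force \<open>B - A = J - I\<close> and \<open>A - B \<subseteq> I - J\<close>, which
  contradicts equal cardinality of bases.\<close>

lemma indep_augment:
  assumes I: "indep I" and J: "indep J" and lt: "card I < card J"
  shows "\<exists>x \<in> J - I. indep (insert x I)"
proof (rule ccontr)
  assume "\<not> ?thesis"
  then have no: "\<not> (I \<subseteq> D \<and> x \<in> D)" if "x \<in> J - I" "D \<in> bases" for x D
    using that by (auto simp: indep_def)
  obtain A where A: "A \<in> bases" "I \<subseteq> A" using I by (auto simp: indep_def)
  obtain B where B: "B \<in> bases" "J \<subseteq> B"
    and min: "\<And>D. D \<in> bases \<Longrightarrow> J \<subseteq> D \<Longrightarrow> card (B - (J \<union> A)) \<le> card (D - (J \<union> A))"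
    using ex_has_least_nat[of "\<lambda>B. B \<in> bases \<and> J \<subseteq> B" _ "\<lambda>B. card (B - (J \<union> A))"] J
    unfolding indep_def by metis
  have JA: "J \<inter> A \<subseteq> I" using no A by blast
  have "B - (J \<union> A) = {}"
  proof (rule ccontr)
    assume "B - (J \<union> A) \<noteq> {}"
    then obtain x where x: "x \<in> B - (J \<union> A)" by blast
    then obtain y where y: "y \<in> A - B" "insert y (B - {x}) \<in> bases"
      using basis_exchange[OF B(1) A(1)] by blast
    \<comment> \<open>Trading \<open>x\<close> for an element of \<open>A\<close> keeps
      \<open>J\<close> inside and lowers the minimized count.\<close>
    have "insert y (B - {x}) - (J \<union> A) = (B - (J \<union> A)) - {x}" using y by auto
    moreover have "card ((B - (J \<union> A)) - {x}) < card (B - (J \<union> A))"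
      using x finite_basis[OF B(1)] by (intro card_Diff1_less) auto
    moreover have "J \<subseteq> insert y (B - {x})" using x B by auto
    ultimately show False using min[OF y(2)] by simp
  qed
  then have BA: "B - A \<subseteq> J - I" using A by blast
  have "A - (I \<union> B) = {}"
  proof (rule ccontr)
    assume "A - (I \<union> B) \<noteq> {}"
    then obtain x where x: "x \<in> A - (I \<union> B)" by blast
    then obtain y where y: "y \<in> B - A" "insert y (A - {x}) \<in> bases"
      using basis_exchange[OF A(1) B(1)] by blast
    \<comment> \<open>Here \<open>y\<close> lies in \<open>J - I\<close> and the exchanged basis
      still contains \<open>I\<close>, so \<open>y\<close> would augment \<open>I\<close>.\<close>
    then show False using no[of y "insert y (A - {x})"] x BA A by blast
  qed
  then have "A - B \<subseteq> I - J" using B by blast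
  then have "card (A - B) \<le> card (I - J)" using indep_finite[OF I] by (intro card_mono) auto
  moreover have "J - I \<subseteq> B - A" using JA B by blast
  then have "card (J - I) \<le> card (B - A)" using finite_basis[OF B(1)] by (intro card_mono) auto
  moreover have "card (A - B) = card (B - A)"
    using card_bases_eq[OF A(1) B(1)] finite_basis A B by (metis card_le_sym_Diff eq_iff le_refl)
  moreover have "card (I - J) < card (J - I)"
    using lt indep_finite I J by (simp add: card_less_sym_Diff)
  ultimately show False by simp
qed

text \<open>Together with \<open>rank_attained\<close>, this identifies the maximum over bases with
  the largest size of an independent subset.\<close>

lemma indep_card_le_rank:
  assumes "indep I" "I \<subseteq> S"
  shows "card I \<le> matroid_rank bases S"
proof -
  obtain B where B: "B \<in> bases" "I \<subseteq> B" using assms by (auto simp: indep_def)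
  then have "card I \<le> card (S \<inter> B)"
    using assms finite_basis by (intro card_mono) auto
  also have "\<dots> \<le> matroid_rank bases S"
    unfolding matroid_rank_def using finite_nonempty_rank_set B by (intro Max_ge) auto
  finally show ?thesis .
qed

lemma rank_attained: "\<exists>I \<subseteq> S. indep I \<and> card I = matroid_rank bases S"
proof -
  have "matroid_rank bases S \<in> {card (S \<inter> B) | B. B \<in> bases}"
    unfolding matroid_rank_def by (rule Max_in) (rule finite_nonempty_rank_set)+
  then obtain B where "B \<in> bases" "matroid_rank bases S = card (S \<inter> B)" by blast
  then show ?thesis by (intro exI[of _ "S \<inter> B"]) (auto simp: indep_def)
qed

lemma extend_to_rank:
  assumes "indep I" "I \<subseteq> S"
  shows "\<exists>J. I \<subseteq> J \<and> J \<subseteq> S \<and> indep J \<and> card J = matroid_rank bases S"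
  using assms
proof (induction "matroid_rank bases S - card I" arbitrary: I)
  case 0
  then show ?case using indep_card_le_rank[of I S] by (intro exI[of _ I]) auto
next
  case (Suc n)
  obtain J where J: "J \<subseteq> S" "indep J" "card J = matroid_rank bases S" using rank_attained by blast
  have "card I < card J" using Suc(2) J(3) by linarith
  then obtain x where x: "x \<in> J - I" "indep (insert x I)"
    using indep_augment[OF Suc.prems(1) J(2)] by blast
  have "n = matroid_rank bases S - card (insert x I)"
    using Suc(2) x indep_finite[OF Suc.prems(1)] by simp
  moreover have "insert x I \<subseteq> S" using x Suc.prems J by auto
  ultimately have "\<exists>K. insert x I \<subseteq> K \<and> K \<subseteq> S \<and> indep K \<and> card K = matroid_rank bases S"
    using Suc(1)[OF _ x(2)] by simp
  then show ?case by auto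
qed

lemma rank_function_matroid_rank: "rank_function (\<lambda>S. int (matroid_rank bases S))"
proof
  show le: "int (matroid_rank bases S) \<le> int (card S)" if "finite S" for S
    using rank_attained[of S] that by (metis card_mono of_nat_mono)
  show "int (matroid_rank bases {}) = 0" using le[of "{}"] by simp
  show "int (matroid_rank bases S) \<le> int (matroid_rank bases T)" if "S \<subseteq> T" for S T
    using rank_attained[of S] indep_card_le_rank[of _ T] that by force
  show "submodular (\<lambda>S. int (matroid_rank bases S))"
    unfolding submodular_def
  proof (intro allI)
    fix S T
    \<comment> \<open>A maximal independent set of the intersection is extended to one of the union;
      its traces on \<open>S\<close> and \<open>T\<close> are independent and overlap at least in
      \<open>I\<close>.\<close>
    obtain I where I: "I \<subseteq> S \<inter> T" "indep I" "card I = matroid_rank bases (S \<inter> T)"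
      using rank_attained by blast
    then obtain J where J: "I \<subseteq> J" "J \<subseteq> S \<union> T" "indep J" "card J = matroid_rank bases (S \<union> T)"
      using extend_to_rank[of I "S \<union> T"] by blast
    have fin: "finite J" using J indep_finite by blast
    have ind: "indep (J \<inter> D)" for D using J(3) by (auto simp: indep_def)
    have "card (J \<inter> S) + card (J \<inter> T) = card (J \<inter> S \<union> J \<inter> T) + card (J \<inter> S \<inter> (J \<inter> T))"
      using fin by (intro card_Un_Int) auto
    also have "J \<inter> S \<union> J \<inter> T = J" using J by auto
    finally have "card J + card (J \<inter> S \<inter> (J \<inter> T)) = card (J \<inter> S) + card (J \<inter> T)" by simp
    moreover have "card I \<le> card (J \<inter> S \<inter> (J \<inter> T))"
      using I J fin by (intro card_mono) auto
    moreover have "card (J \<inter> S) \<le> matroid_rank bases S" "card (J \<inter> T) \<le> matroid_rank bases T"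
      using ind by (auto intro: indep_card_le_rank)
    ultimately show "int (matroid_rank bases (S \<union> T)) + int (matroid_rank bases (S \<inter> T))
        \<le> int (matroid_rank bases S) + int (matroid_rank bases T)"
      using I J by linarith
  qed
qed

lemma rank_basis: "B \<in> bases \<Longrightarrow> matroid_rank bases B = card B"
  using indep_card_le_rank[of B B] rank_attained[of B] finite_basis[of B] card_mono[of B]
  by (metis indep_def le_antisym order_refl)

lemma rank_le_card_basis:
  assumes "B \<in> bases"
  shows "matroid_rank bases S \<le> card B"
proof -
  obtain I where I: "indep I" "card I = matroid_rank bases S" using rank_attained by blast
  then obtain D where "D \<in> bases" "I \<subseteq> D" by (auto simp: indep_def)
  then show ?thesis using I card_bases_eq[OF assms] finite_basis card_mono by metis
qed

lemma basis_if_full_rank: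
  assumes "B \<in> bases" "finite D" "card D = card B" "matroid_rank bases D = card B"
  shows "D \<in> bases"
proof -
  obtain I where I: "I \<subseteq> D" "indep I" "card I = card D" using rank_attained[of D] assms by auto
  then have "I = D" using assms(2) card_subset_eq by blast
  then obtain C where C: "C \<in> bases" "D \<subseteq> C" using I by (auto simp: indep_def)
  then have "D = C" using card_bases_eq[OF assms(1)] assms(3) finite_basis by (metis card_subset_eq)
  then show ?thesis using C by simp
qed

end

section \<open>Reduction to disjoint bases\<close>

theorem theorem1p5:
  fixes E :: "'a set" and bases :: "'a set set" and A B X Y :: "'a set"
  assumes "matroid E bases"
    and "A \<in> bases" and "B \<in> bases"
    and "X \<subseteq> A - B" and "Y \<subseteq> B - A"
  shows "\<exists>U V. U \<subseteq> A - B \<and> V \<subseteq> B - A \<and> X \<subseteq> U \<and> Y \<subseteq> V \<and>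
           card U = card V \<and> card V \<le> matroid_rank bases (X \<union> Y) \<and>
           (A - U) \<union> V \<in> bases \<and> (B - V) \<union> U \<in> bases"
proof -
  interpret matroid E bases by fact
  define rk where "rk = (\<lambda>S. int (matroid_rank bases S))"
  define C where "C = A \<inter> B"
  interpret rk: rank_function rk unfolding rk_def by (rule rank_function_matroid_rank)
  \<comment> \<open>In the contraction by \<open>A \<inter> B\<close>, the sets \<open>A - B\<close>
    and \<open>B - A\<close> are disjoint bases.\<close>
  define s where "s = (\<lambda>S. rk (S \<union> C) - rk C)"
  interpret s: rank_function s unfolding s_def by (rule rk.contract)
  have fin: "finite A" "finite B" "finite C" using assms finite_basis by (auto simp: C_def)
  have AB: "card A = card B" by (rule card_bases_eq[OF assms(2,3)])
  have rkA: "rk A = int (card A)" and rkB: "rk B = int (card B)"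
    using rank_basis assms by (auto simp: rk_def)
  have rkC: "rk C = int (card C)"
    by (rule rk.independent_subset[OF fin(1) rkA]) (simp add: C_def)
  have cards: "card A = card (A - B) + card C" "card B = card (B - A) + card C"
    using fin card_Int_Diff[of A B] card_Int_Diff[of B A] by (auto simp: C_def Int_commute)
  have un: "A - B \<union> C = A" "B - A \<union> C = B" by (auto simp: C_def)
  have sA: "s (A - B) = int (card (A - B))" and sB: "s (B - A) = int (card (B - A))"
    using rkA rkB rkC cards un by (auto simp: s_def)
  have "rk B \<le> rk ((A - B) \<union> (B - A) \<union> C)" by (rule rk.mono) (auto simp: C_def)
  moreover have "rk ((A - B) \<union> (B - A) \<union> C) \<le> int (card B)"
    using rank_le_card_basis[OF assms(3)] by (simp add: rk_def)
  ultimately have sAB: "s ((A - B) \<union> (B - A)) = int (card (B - A))"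
    using rkB rkC cards by (auto simp: s_def)
  have AB': "finite (A - B)" "finite (B - A)" "(A - B) \<inter> (B - A) = {}" "card (A - B) = card (B - A)"
    using fin AB cards by auto
  obtain U V where U: "X \<subseteq> U" "U \<subseteq> A - B" and V: "Y \<subseteq> V" "V \<subseteq> B - A"
    and UV: "card U = card V" "int (card V) \<le> s (X \<union> Y)"
    and sUV: "s ((A - B - U) \<union> V) = int (card (A - B))" "s ((B - A - V) \<union> U) = int (card (A - B))"
    using s.exchange_disjoint[OF AB'(1-3) sA sB AB'(4) sAB assms(4,5)] by blast
  have eq: "(A - B - U) \<union> V \<union> C = (A - U) \<union> V" "(B - A - V) \<union> U \<union> C = (B - V) \<union> U"
    using U V by (auto simp: C_def)
  have sub: "U \<subseteq> A" "V \<subseteq> B" using U V by auto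
  then have finUV: "finite U" "finite V" using fin finite_subset by blast+
  have "card ((A - U) \<union> V) = card (A - U) + card V"
    using fin finUV V by (intro card_Un_disjoint) auto
  also have "\<dots> = card B"
    using finUV sub AB UV card_mono[OF fin(1) sub(1)] by (simp add: card_Diff_subset)
  finally have c1: "card ((A - U) \<union> V) = card B" .
  have "card ((B - V) \<union> U) = card (B - V) + card U"
    using fin finUV U by (intro card_Un_disjoint) auto
  also have "\<dots> = card B"
    using finUV sub UV card_mono[OF fin(2) sub(2)] by (simp add: card_Diff_subset)
  finally have c2: "card ((B - V) \<union> U) = card B" .
  have "rk ((A - U) \<union> V) = int (card B)" "rk ((B - V) \<union> U) = int (card B)"
    using sUV rkC cards AB by (auto simp: s_def eq)
  then have "(A - U) \<union> V \<in> bases" "(B - V) \<union> U \<in> bases"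
    using c1 c2 fin finUV by (auto simp: rk_def intro!: basis_if_full_rank[OF assms(3)])
  \<comment> \<open>Contraction does not increase rank, so the bound in terms of \<open>s\<close>
    carries over.\<close>
  moreover have "card V \<le> matroid_rank bases (X \<union> Y)"
    using UV rk.subadditive[of "X \<union> Y" C] by (simp add: s_def) (simp add: rk_def)
  ultimately show ?thesis using U V UV by blast
qed

end
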